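(* Let $\mathcal{F}_{Hc}$ denote the class of graphs containing a Hamiltonian cycle. For every even $n>2$ for which the complete graph $K_n$ has a perfect $1$-factorization, we have $$M_{\mathcal{F}_{Hc}}(n)=2^{n-2}.$$ In particular, this equality holds if $n=p+1$ or $n=2p$ for some odd prime $p$.
   Context: All graphs are finite and simple. For two graphs $G,G'$ on the vertex set $[n]=\{1,\dots,n\}$, $G\oplus G'$ denotes the graph on $[n]$ whose edge set is the symmetric difference of $E(G)$ and $E(G')$. For a class $\mathcal{F}$ of graphs, a family $\mathcal{G}$ of (labeled) graphs on vertex set $[n]$ is called $\mathcal{F}$-good if $G\oplus G'\in\mathcal{F}$ for any two distinct members $G,G'\in\mathcal{G}$. $M_{\mathcal{F}}(n)$ denotes the maximum possible size of an $\mathcal{F}$-good family on vertex set $[n]$. A perfect $1$-factorization of a graph is a partition of its edge set into perfect matchings such that the union of any two of these perfect matchings is a Hamiltonian cycle. *)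

theory Defs
  imports "HOL-Library.Disjoint_Sets" "HOL-Computational_Algebra.Primes"
begin

type_synonym 'a graph = "'a set \<times> 'a set set"

abbreviation verts :: "'a graph \<Rightarrow> 'a set" where
  "verts G \<equiv> fst G"

abbreviation edges :: "'a graph \<Rightarrow> 'a set set" where
  "edges G \<equiv> snd G"

definition all_edges :: "'a set \<Rightarrow> 'a set set" where
  "all_edges V = {e. e \<subseteq> V \<and> card e = 2}"

definition simple_graph :: "'a graph \<Rightarrow> bool" where
  "simple_graph G \<longleftrightarrow> finite (verts G) \<and> edges G \<subseteq> all_edges (verts G)"

definition graphs_on :: "nat \<Rightarrow> nat graph set" where
  "graphs_on n = {G. simple_graph G \<and> verts G = {1..n}}"

definition complete_graph :: "nat \<Rightarrow> nat graph" where
  "complete_graph n = ({1..n}, all_edges {1..n})"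

text \<open>Used only for two graphs on the same vertex set.\<close>

definition graph_xor :: "'a graph \<Rightarrow> 'a graph \<Rightarrow> 'a graph"  (infixl "\<oplus>\<^sub>g" 65) where
  "G \<oplus>\<^sub>g H = (verts G, sym_diff (edges G) (edges H))"

definition good_family :: "nat graph set \<Rightarrow> nat \<Rightarrow> nat graph set \<Rightarrow> bool" where
  "good_family F n \<G> \<longleftrightarrow>
     \<G> \<subseteq> graphs_on n \<and> (\<forall>G\<in>\<G>. \<forall>H\<in>\<G>. G \<noteq> H \<longrightarrow> G \<oplus>\<^sub>g H \<in> F)"

definition max_good :: "nat graph set \<Rightarrow> nat \<Rightarrow> nat" where
  "max_good F n = Max {card \<G> | \<G>. good_family F n \<G>}"

text \<open>A cyclic ordering of vertices \<open>vs\<close> has its consecutive pairs, including the pair closing up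
  the last vertex with the first, as edges.\<close>

definition cycle_edges :: "'a list \<Rightarrow> 'a set set" where
  "cycle_edges vs = {{vs ! i, vs ! (Suc i mod length vs)} | i. i < length vs}"

definition is_hamiltonian_cycle :: "'a set \<Rightarrow> 'a set set \<Rightarrow> bool" where
  "is_hamiltonian_cycle V C \<longleftrightarrow>
     (\<exists>vs. distinct vs \<and> set vs = V \<and> length vs \<ge> 3 \<and> C = cycle_edges vs)"

definition hamiltonian_graphs :: "'a graph set" where
  "hamiltonian_graphs =
     {G. simple_graph G \<and> (\<exists>C \<subseteq> edges G. is_hamiltonian_cycle (verts G) C)}"

definition perfect_matching :: "'a graph \<Rightarrow> 'a set set \<Rightarrow> bool" where
  "perfect_matching G M \<longleftrightarrow> M \<subseteq> edges G \<and> (\<forall>v\<in>verts G. \<exists>!e. e \<in> M \<and> v \<in> e)"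

definition perfect_1_factorization :: "'a graph \<Rightarrow> 'a set set set \<Rightarrow> bool" where
  "perfect_1_factorization G P \<longleftrightarrow>
     partition_on (edges G) P \<and>
     (\<forall>M\<in>P. perfect_matching G M) \<and>
     (\<forall>M\<in>P. \<forall>N\<in>P. M \<noteq> N \<longrightarrow> is_hamiltonian_cycle (verts G) (M \<union> N))"

text \<open>The maximum in \<open>max_good\<close> is taken over a finite nonempty set.\<close>

lemma finite_graphs_on: "finite (graphs_on n)"
proof (rule finite_subset)
  show "graphs_on n \<subseteq> {{1..n}} \<times> Pow (Pow {1..n})"
  proof
    fix G assume "G \<in> graphs_on n"
    then have "fst G = {1..n}" "snd G \<subseteq> Pow {1..n}"
      unfolding graphs_on_def simple_graph_def all_edges_def by blast+
    then show "G \<in> {{1..n}} \<times> Pow (Pow {1..n})"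
      unfolding mem_Times_iff by blast
  qed
qed simp

lemma max_good_wf:
  "finite {card \<G> | \<G>. good_family F n \<G>}" "{card \<G> | \<G>. good_family F n \<G>} \<noteq> {}"
proof -
  have "{card \<G> | \<G>. good_family F n \<G>} \<subseteq> card ` Pow (graphs_on n)"
    by (auto simp: good_family_def)
  then show "finite {card \<G> | \<G>. good_family F n \<G>}"
    by (rule finite_subset) (simp add: finite_graphs_on)
  have "good_family F n {}" by (simp add: good_family_def)
  then show "{card \<G> | \<G>. good_family F n \<G>} \<noteq> {}" by blast
qed

end

theory Submission
  imports Defs
begin

text \<open>
  Upper bound. Fix two vertices, \<open>1\<close> and \<open>2\<close>. If two graphs contain the same edges
  \<open>{1, x}\<close> with \<open>x \<ge> 3\<close>, then vertex \<open>1\<close> has degree at most one in their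
  symmetric difference, which therefore has no Hamiltonian cycle. A good family thus has at most
  as many members as there are sets of these \<open>n - 2\<close> edges (\<open>good_family_card_le\<close>).

  Lower bound. The \<open>n - 1\<close> matchings of a perfect 1-factorization have \<open>2 ^ (n - 2)\<close>
  subsets of even size; take the graphs that are unions of these. The symmetric difference of two
  such graphs is again the union of a nonempty even number of matchings, so it contains the union
  of two matchings, which is a Hamiltonian cycle (\<open>max_good_hamiltonian_ge\<close>).

  The primes. A suitable collection of \<open>n - 1\<close> edge sets is obtained as the classes of an edge
  colouring, and each pair of classes is shown to contain a Hamiltonian cycle by writing the cycle
  down (\<open>max_good_hamiltonian_of_colouring\<close>). For \<open>n = p + 1\<close> the vertices are
  the residues modulo \<open>p\<close> and a point at infinity; the edge \<open>{a, b}\<close> gets colour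
  \<open>a + b\<close> and the edge from \<open>a\<close> to infinity gets colour \<open>2a\<close>. For
  \<open>n = 2p\<close> the vertices are the residues modulo \<open>2p\<close>. Edges inside a parity class
  are coloured by their sum, edges \<open>{a, a + p}\<close> by \<open>2a\<close>, and the remaining edges
  by the difference from their odd to their even end. The colours are all residues but
  \<open>p\<close>. In both cases the vertices met by a walk that alternates between two
  colours lie along an arithmetic progression, and primality of \<open>p\<close> makes this
  progression run through all residues, or all residues of one parity, before it repeats.
\<close>

section \<open>Hamiltonian cycles\<close>

lemma hamiltonian_cycle_two_edges_at:
  assumes "is_hamiltonian_cycle V C" "v \<in> V"
  obtains a b where "a \<noteq> b" "{v, a} \<in> C" "{v, b} \<in> C"
proof -
  obtain vs where vs: "distinct vs" "set vs = V" "length vs \<ge> 3" "C = cycle_edges vs"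
    using assms(1) unfolding is_hamiltonian_cycle_def by blast
  let ?n = "length vs"
  obtain i where i: "i < ?n" "v = vs ! i"
    using assms(2) vs(2) by (metis in_set_conv_nth)
  define j where "j = (if i = 0 then ?n - 1 else i - 1)"
  have j: "j < ?n" "Suc j mod ?n = i"
    using i vs(3) by (auto simp: j_def)
  have "Suc i mod ?n \<noteq> j"
    using i vs(3) by (cases "Suc i = ?n") (auto simp: j_def)
  then have "vs ! (Suc i mod ?n) \<noteq> vs ! j"
    using vs(1) i(1) j(1) nth_eq_iff_index_eq[of vs "Suc i mod ?n" j]
    by (metis length_pos_if_in_set mod_less_divisor nth_mem)
  moreover have "{v, vs ! (Suc i mod ?n)} \<in> C"
    using vs(4) i unfolding cycle_edges_def by blast
  moreover have "{vs ! j, vs ! (Suc j mod ?n)} \<in> C"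
    using vs(4) j(1) unfolding cycle_edges_def by blast
  then have "{v, vs ! j} \<in> C"
    using j(2) i(2) by (simp add: insert_commute)
  ultimately show thesis using that by blast
qed

lemma hamiltonian_cycle_from_sequence:
  assumes "inj_on x {..<n}" "x ` {..<n} = V" "n \<ge> 3"
    and E: "\<And>k. k < n \<Longrightarrow> {x k, x (Suc k mod n)} \<in> E"
  shows "\<exists>C\<subseteq>E. is_hamiltonian_cycle V C"
proof (intro exI conjI)
  let ?vs = "map x [0..<n]"
  have eq: "cycle_edges ?vs = {{x k, x (Suc k mod n)} | k. k < n}"
  proof -
    have "?vs ! k = x k \<and> ?vs ! (Suc k mod n) = x (Suc k mod n)" if "k < n" for k
      using that by simp
    then show ?thesis unfolding cycle_edges_def by force
  qed
  show "cycle_edges ?vs \<subseteq> E" unfolding eq using E by blast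
  have "distinct ?vs" "set ?vs = V"
    using assms(1,2) by (simp_all add: distinct_map atLeast0LessThan)
  then show "is_hamiltonian_cycle V (cycle_edges ?vs)"
    using \<open>n \<ge> 3\<close> unfolding is_hamiltonian_cycle_def by (intro exI[of _ ?vs]) simp
qed

section \<open>The upper bound\<close>

text \<open>A graph is determined within a good family by the \<open>n - 2\<close> possible edges at vertex
  \<open>1\<close> that avoid vertex \<open>2\<close>: a Hamiltonian cycle in the symmetric difference uses
  two edges at \<open>1\<close>, and at most one of them goes to \<open>2\<close>.\<close>

lemma good_family_card_le:
  assumes good: "good_family hamiltonian_graphs n \<G>" and n: "n \<ge> 3"
  shows "card \<G> \<le> 2 ^ (n - 2)"
proof -
  define S where "S = (\<lambda>x. {1, x}) ` {3..n}"
  have cS: "card S = n - 2"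
    unfolding S_def by (subst card_image) (auto simp: inj_on_def doubleton_eq_iff)
  have "inj_on (\<lambda>G. edges G \<inter> S) \<G>"
  proof (rule inj_onI, rule ccontr)
    fix G H assume GH: "G \<in> \<G>" "H \<in> \<G>" "edges G \<inter> S = edges H \<inter> S" "G \<noteq> H"
    have "G \<in> graphs_on n" "H \<in> graphs_on n"
      using GH(1,2) good unfolding good_family_def by auto
    then have on: "edges G \<union> edges H \<subseteq> all_edges {1..n}" "verts G = {1..n}"
      unfolding graphs_on_def simple_graph_def by auto
    have "G \<oplus>\<^sub>g H \<in> hamiltonian_graphs"
      using good GH(1,2,4) unfolding good_family_def by blast
    then obtain C where C: "C \<subseteq> sym_diff (edges G) (edges H)" "is_hamiltonian_cycle {1..n} C"
      using on(2) unfolding hamiltonian_graphs_def graph_xor_def by auto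
    obtain a b where ab: "a \<noteq> b" "{1, a} \<in> C" "{1, b} \<in> C"
      using hamiltonian_cycle_two_edges_at[OF C(2), of 1] n by auto
    have range: "x \<in> {2..n}" if "{1, x} \<in> C" for x
    proof -
      have "{1, x} \<in> all_edges {1..n}" using that C(1) on(1) by blast
      then have "x \<noteq> 1" "x \<in> {1..n}" unfolding all_edges_def by auto
      then show ?thesis by auto
    qed
    obtain x where "{1, x} \<in> C" "x \<noteq> 2" using ab by metis
    then have "{1, x} \<in> C \<inter> S" using range[of x] unfolding S_def by auto
    then show False using C(1) GH(3) by blast
  qed
  moreover have "(\<lambda>G. edges G \<inter> S) ` \<G> \<subseteq> Pow S" by blast
  moreover have fS: "finite S" unfolding S_def by simp
  then have "finite (Pow S)" by simp
  ultimately have "card \<G> \<le> card (Pow S)" by (rule card_inj_on_le)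
  then show ?thesis using cS fS by (simp add: card_Pow)
qed

lemma max_good_hamiltonian_le:
  assumes "n \<ge> 3"
  shows "max_good hamiltonian_graphs n \<le> 2 ^ (n - 2)"
  unfolding max_good_def
  by (rule Max.boundedI) (use max_good_wf good_family_card_le[OF _ assms] in auto)

section \<open>The lower bound from pairwise Hamiltonian unions\<close>

text \<open>Once a subset of \<open>C - {c}\<close> is chosen, parity decides whether \<open>c\<close> is added.\<close>

lemma card_even_subsets:
  assumes "finite C" "C \<noteq> {}"
  shows "card {S. S \<subseteq> C \<and> even (card S)} = 2 ^ (card C - 1)"
proof -
  obtain c where c: "c \<in> C" using assms(2) by blast
  let ?g = "\<lambda>S. if even (card S) then S else insert c S"
  have fin: "finite S" if "S \<subseteq> C" for S using that assms(1) finite_subset by blast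
  have "bij_betw (\<lambda>S. S - {c}) {S. S \<subseteq> C \<and> even (card S)} (Pow (C - {c}))"
  proof (rule bij_betw_byWitness[where f' = ?g])
    show "\<forall>S\<in>{S. S \<subseteq> C \<and> even (card S)}. ?g (S - {c}) = S"
    proof
      fix S assume S: "S \<in> {S. S \<subseteq> C \<and> even (card S)}"
      show "?g (S - {c}) = S"
      proof (cases "c \<in> S")
        case True
        then have "card S = Suc (card (S - {c}))"
          using S fin by (metis (no_types, lifting) card.remove mem_Collect_eq)
        then show ?thesis using S True by auto
      qed (use S in auto)
    qed
    show "\<forall>T\<in>Pow (C - {c}). ?g T - {c} = T" by auto
    show "(\<lambda>S. S - {c}) ` {S. S \<subseteq> C \<and> even (card S)} \<subseteq> Pow (C - {c})" by auto
    show "?g ` Pow (C - {c}) \<subseteq> {S. S \<subseteq> C \<and> even (card S)}"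
    proof (rule image_subsetI)
      fix T assume T: "T \<in> Pow (C - {c})"
      then have "card (insert c T) = Suc (card T)" by (subst card_insert_disjoint) (auto intro: fin)
      then show "?g T \<in> {S. S \<subseteq> C \<and> even (card S)}" using T c by auto
    qed
  qed
  then have "card {S. S \<subseteq> C \<and> even (card S)} = card (Pow (C - {c}))"
    by (rule bij_betw_same_card)
  then show ?thesis using assms(1) c by (simp add: card_Pow)
qed

lemma even_sym_diff_two_elements:
  assumes "finite S" "finite T" "even (card S)" "even (card T)" "S \<noteq> T"
  obtains i j where "i \<noteq> j" "i \<in> sym_diff S T" "j \<in> sym_diff S T"
proof -
  have "card (sym_diff S T) = card (S - T) + card (T - S)"
    using assms(1,2) by (intro card_Un_disjoint) auto
  moreover have "card S = card (S - T) + card (S \<inter> T)" "card T = card (T - S) + card (S \<inter> T)"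
    using assms(1,2) by (metis card_Diff_subset_Int card_Int_Diff inf_commute finite_Int add.commute)+
  ultimately have ev: "even (card (sym_diff S T))" using assms(3,4) by presburger
  obtain i where i: "i \<in> sym_diff S T" using assms(5) by blast
  have "sym_diff S T \<noteq> {i}" using ev by (metis card_1_singleton_iff odd_one One_nat_def)
  then show thesis using that i by blast
qed

text \<open>The graphs are the unions over even subsets of the index set. Distinct even subsets
  differ in at least two indices \<open>i\<close> and \<open>j\<close>, and by disjointness nothing of
  \<open>M i \<union> M j\<close> cancels in the symmetric difference. The edge sets are indexed so that the
  lemma applies both to the members of a factorization and to the classes of a colouring.\<close>

lemma max_good_hamiltonian_ge:
  fixes M :: "'c \<Rightarrow> nat set set"
  assumes n: "n \<ge> 3" and C: "finite C" "card C = n - 1"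
    and sub: "\<And>i. i \<in> C \<Longrightarrow> M i \<subseteq> all_edges {1..n}"
    and disj: "\<And>i j. i \<in> C \<Longrightarrow> j \<in> C \<Longrightarrow> i \<noteq> j \<Longrightarrow> M i \<inter> M j = {}"
    and ham: "\<And>i j. i \<in> C \<Longrightarrow> j \<in> C \<Longrightarrow> i \<noteq> j \<Longrightarrow>
                \<exists>D\<subseteq>M i \<union> M j. is_hamiltonian_cycle {1..n} D"
  shows "2 ^ (n - 2) \<le> max_good hamiltonian_graphs n"
proof -
  define E where "E = {S. S \<subseteq> C \<and> even (card S)}"
  define g where "g S = ({1..n}, \<Union>i\<in>S. M i)" for S
  have xor: "\<exists>D\<subseteq>edges (g S \<oplus>\<^sub>g g T). is_hamiltonian_cycle {1..n} D"
    if ST: "S \<in> E" "T \<in> E" "S \<noteq> T" for S T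
  proof -
    have sub': "S \<subseteq> C" "T \<subseteq> C" and "finite S" "finite T" "even (card S)" "even (card T)"
      using ST C(1) finite_subset unfolding E_def by auto
    then obtain i j where ij: "i \<noteq> j" "i \<in> sym_diff S T" "j \<in> sym_diff S T"
      using ST(3) even_sym_diff_two_elements by metis
    have "M k \<subseteq> edges (g S \<oplus>\<^sub>g g T)" if k: "k \<in> sym_diff S T" for k
    proof -
      have "M k \<inter> M l = {}" if "l \<in> S \<and> k \<notin> S \<or> l \<in> T \<and> k \<notin> T" for l
        using that k sub' by (intro disj) auto
      then show ?thesis using k unfolding g_def graph_xor_def by auto
    qed
    then have "M i \<union> M j \<subseteq> edges (g S \<oplus>\<^sub>g g T)" using ij by blast
    moreover have "i \<in> C" "j \<in> C" using ij(2,3) sub' by auto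
    then obtain D where "D \<subseteq> M i \<union> M j" "is_hamiltonian_cycle {1..n} D"
      using ham ij(1) by blast
    ultimately show ?thesis by blast
  qed
  have on: "g S \<in> graphs_on n" if "S \<in> E" for S
    using that sub unfolding E_def g_def graphs_on_def simple_graph_def by auto
  \<comment> \<open>A Hamiltonian symmetric difference is nonempty, so distinct subsets give distinct graphs.\<close>
  have inj: "inj_on g E"
  proof (rule inj_onI, rule ccontr)
    fix S T assume ST: "S \<in> E" "T \<in> E" "g S = g T" "S \<noteq> T"
    then obtain D where "D \<subseteq> {}" "is_hamiltonian_cycle {1..n} D"
      using xor[of S T] by (auto simp: graph_xor_def)
    then show False using hamiltonian_cycle_two_edges_at[of "{1..n}" D 1] n by auto
  qed
  have "good_family hamiltonian_graphs n (g ` E)"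
    unfolding good_family_def
  proof (intro conjI ballI impI)
    show "g ` E \<subseteq> graphs_on n" using on by blast
    fix G H assume "G \<in> g ` E" "H \<in> g ` E" "G \<noteq> H"
    then obtain S T where ST: "S \<in> E" "T \<in> E" "S \<noteq> T" "G = g S" "H = g T" by blast
    have "simple_graph (g S \<oplus>\<^sub>g g T)" "verts (g S \<oplus>\<^sub>g g T) = {1..n}"
      using on[OF ST(1)] on[OF ST(2)] unfolding graphs_on_def simple_graph_def graph_xor_def by auto
    then show "G \<oplus>\<^sub>g H \<in> hamiltonian_graphs"
      using xor[OF ST(1-3)] ST(4,5) unfolding hamiltonian_graphs_def by simp
  qed
  then have "card (g ` E) \<le> max_good hamiltonian_graphs n"
    unfolding max_good_def by (intro Max_ge max_good_wf(1)) blast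
  moreover have "card (g ` E) = 2 ^ (n - 2)"
  proof -
    have "C \<noteq> {}" using C(2) n by auto
    then have "card E = 2 ^ (card C - 1)" unfolding E_def using C(1) by (intro card_even_subsets)
    then show ?thesis using card_image[OF inj] C(2) by (simp add: numeral_2_eq_2)
  qed
  ultimately show ?thesis by simp
qed

section \<open>Perfect 1-factorizations and edge colourings\<close>

text \<open>Each of the \<open>n - 1\<close> edges at vertex \<open>1\<close> lies in exactly one matching,
  and each matching covers vertex \<open>1\<close> with exactly one edge.\<close>

lemma card_perfect_1_factorization:
  assumes P: "perfect_1_factorization (complete_graph n) P" and n: "n \<ge> 1"
  shows "card P = n - 1"
proof -
  have part: "partition_on (all_edges {1..n}) P"
    and pm: "\<And>M. M \<in> P \<Longrightarrow> perfect_matching (complete_graph n) M"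
    using P unfolding perfect_1_factorization_def complete_graph_def by auto
  have uniq: "\<exists>!M. M \<in> P \<and> e \<in> M" if "e \<in> all_edges {1..n}" for e
    using that partition_onD1[OF part] partition_onD2[OF part] unfolding disjoint_def by blast
  define m where "m v = (THE M. M \<in> P \<and> {1, v} \<in> M)" for v :: nat
  have m: "m v \<in> P \<and> {1, v} \<in> m v" if "v \<in> {2..n}" for v
  proof -
    have "{1, v} \<in> all_edges {1..n}" using that unfolding all_edges_def by auto
    then have "\<exists>!M. M \<in> P \<and> {1, v} \<in> M" using uniq by blast
    then show ?thesis unfolding m_def by (rule theI')
  qed
  have "bij_betw m {2..n} P"
    unfolding bij_betw_def
  proof (intro conjI inj_onI subset_antisym subsetI)
    fix v w assume vw: "v \<in> {2..n}" "w \<in> {2..n}" "m v = m w"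
    have "{1, v} \<in> m v" "{1, w} \<in> m v" "perfect_matching (complete_graph n) (m v)"
      using m[OF vw(1)] m[OF vw(2)] vw(3) pm by auto
    moreover have "1 \<in> verts (complete_graph n)" using n by (simp add: complete_graph_def)
    ultimately have "{1, v} = {1, w}"
      unfolding perfect_matching_def by blast
    then show "v = w" by (auto simp: doubleton_eq_iff)
  next
    fix M assume "M \<in> m ` {2..n}"
    then show "M \<in> P" using m by auto
  next
    fix M assume M: "M \<in> P"
    have "perfect_matching (complete_graph n) M" using pm M by blast
    then obtain e where e: "e \<in> M" "1 \<in> e" "e \<in> all_edges {1..n}"
      using n unfolding perfect_matching_def complete_graph_def by fastforce
    then have "\<exists>v. e = {1, v} \<and> v \<noteq> 1"
      unfolding all_edges_def using card_2_iff[of e] by auto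
    then obtain v where v: "e = {1, v}" "v \<noteq> 1" by blast
    have vn: "v \<in> {2..n}" using e(3) v unfolding all_edges_def by auto
    have "m v = M"
      using m[OF vn] e(1) v(1) M uniq[OF e(3)] by blast
    then show "M \<in> m ` {2..n}" using vn by blast
  qed
  then have "card {2..n} = card P" by (rule bij_betw_same_card)
  then show ?thesis by simp
qed

lemma max_good_hamiltonian_of_factorization:
  assumes P: "perfect_1_factorization (complete_graph n) P" and n: "n \<ge> 3"
  shows "max_good hamiltonian_graphs n = 2 ^ (n - 2)"
proof (rule antisym[OF max_good_hamiltonian_le[OF n]])
  have part: "partition_on (all_edges {1..n}) P"
    and ham: "\<And>M N. M \<in> P \<Longrightarrow> N \<in> P \<Longrightarrow> M \<noteq> N \<Longrightarrow> is_hamiltonian_cycle {1..n} (M \<union> N)"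
    using P unfolding perfect_1_factorization_def complete_graph_def by auto
  have cP: "card P = n - 1" using card_perfect_1_factorization[OF P] n by simp
  show "2 ^ (n - 2) \<le> max_good hamiltonian_graphs n"
  proof (rule max_good_hamiltonian_ge[where C = P and M = "\<lambda>M. M"])
    show "finite P" using cP n by (intro card_ge_0_finite) simp
    show "M \<inter> N = {}" if "M \<in> P" "N \<in> P" "M \<noteq> N" for M N
      using part that unfolding partition_on_def disjoint_def by blast
    show "M \<subseteq> all_edges {1..n}" if "M \<in> P" for M
      using that partition_onD1[OF part] by blast
    show "\<exists>D\<subseteq>M \<union> N. is_hamiltonian_cycle {1..n} D" if "M \<in> P" "N \<in> P" "M \<noteq> N" for M N
      using ham[OF that] by blast
  qed (fact n cP)+
qed

text \<open>A colouring is a symmetric function, so its classes are disjoint. A Hamiltonian cycle is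
  presented by an injective sequence of \<open>n\<close> vertices; by counting, it visits all of them.\<close>

lemma max_good_hamiltonian_of_colouring:
  fixes col :: "nat \<Rightarrow> nat \<Rightarrow> 'c"
  assumes n: "n \<ge> 3" and sym: "\<And>a b. col a b = col b a"
    and C: "finite C" "card C = n - 1"
    and seq: "\<And>i j. i \<in> C \<Longrightarrow> j \<in> C \<Longrightarrow> i \<noteq> j \<Longrightarrow>
      \<exists>x. inj_on x {..<n} \<and> x ` {..<n} \<subseteq> {1..n} \<and>
        (\<forall>k<n. col (x k) (x (Suc k mod n)) \<in> {i, j})"
  shows "max_good hamiltonian_graphs n = 2 ^ (n - 2)"
proof (rule antisym[OF max_good_hamiltonian_le[OF n]])
  define M where "M i = {{a, b} | a b. a \<noteq> b \<and> {a, b} \<subseteq> {1..n} \<and> col a b = i}" for i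
  show "2 ^ (n - 2) \<le> max_good hamiltonian_graphs n"
  proof (rule max_good_hamiltonian_ge[where C = C and M = M, OF n C])
    show "M i \<subseteq> all_edges {1..n}" for i
      unfolding M_def all_edges_def by auto
    show "M i \<inter> M j = {}" if "i \<noteq> j" for i j
      using that sym unfolding M_def by (auto simp: doubleton_eq_iff)
  next
    fix i j assume "i \<in> C" "j \<in> C" "i \<noteq> j"
    then obtain x where x: "inj_on x {..<n}" "x ` {..<n} \<subseteq> {1..n}"
      "\<And>k. k < n \<Longrightarrow> col (x k) (x (Suc k mod n)) \<in> {i, j}"
      using seq[of i j] by blast
    have "card (x ` {..<n}) = card {1..n}" using card_image[OF x(1)] by simp
    then have onto: "x ` {..<n} = {1..n}" using x(2) by (intro card_subset_eq) auto
    show "\<exists>D\<subseteq>M i \<union> M j. is_hamiltonian_cycle {1..n} D"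
    proof (rule hamiltonian_cycle_from_sequence[OF x(1) onto n])
      fix k assume k: "k < n"
      have k': "Suc k mod n < n" "Suc k mod n \<noteq> k"
        using k n by (cases "Suc k = n"; simp)+
      have "x k \<noteq> x (Suc k mod n)" using x(1) k k' by (auto dest: inj_onD)
      moreover have "{x k, x (Suc k mod n)} \<subseteq> {1..n}" using x(2) k k'(1) by blast
      ultimately show "{x k, x (Suc k mod n)} \<in> M i \<union> M j"
        using x(3)[OF k] unfolding M_def by blast
    qed
  qed
qed

section \<open>Residues and zigzag walks\<close>

text \<open>The vertex \<open>m\<close> stands for the residue \<open>0\<close>, every other vertex for itself.\<close>

definition residue_vertex :: "nat \<Rightarrow> int \<Rightarrow> nat" where
  "residue_vertex m x = Suc (nat ((x - 1) mod int m))"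

lemma residue_vertex_range: "m > 0 \<Longrightarrow> residue_vertex m x \<in> {1..m}"
  unfolding residue_vertex_def by (simp add: Suc_le_eq nat_less_iff)

lemma residue_vertex_cong: "m > 0 \<Longrightarrow> int m dvd int (residue_vertex m x) - x"
proof -
  assume "m > 0"
  then have "int (residue_vertex m x) - x = - ((x - 1) - (x - 1) mod int m)"
    unfolding residue_vertex_def by simp
  then show ?thesis by (metis dvd_minus_iff dvd_minus_mod)
qed

lemma residue_vertex_eqD:
  "m > 0 \<Longrightarrow> residue_vertex m x = residue_vertex m y \<Longrightarrow> int m dvd x - y"
  using dvd_diff[OF residue_vertex_cong[of m y] residue_vertex_cong[of m x]] by simp

lemma mod_eqI:
  fixes a i m :: int
  assumes "m dvd a - i" "0 \<le> i" "i < m"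
  shows "a mod m = i"
proof -
  have "a mod m = i mod m" using assms(1) by (simp add: mod_eq_dvd_iff)
  then show ?thesis using assms(2,3) by simp
qed

text \<open>The sequence 0, 1, -1, 2, -2, ... Sums of neighbours are alternately 1 and 0, so the walk
  \<open>s + d * zigzag k\<close> has neighbour sums alternating between \<open>2s + d\<close> and
  \<open>2s\<close>. Its first \<open>p\<close> values are distinct modulo an odd \<open>p\<close>, being the
  integers of absolute value below \<open>p / 2\<close>.\<close>

definition zigzag :: "nat \<Rightarrow> int" where
  "zigzag k = (if even k then - int (k div 2) else int (k div 2) + 1)"

lemma zigzag_0: "zigzag 0 = 0"
  by (simp add: zigzag_def)

lemma zigzag_step: "zigzag k + zigzag (Suc k) = (if even k then 1 else 0)"
  unfolding zigzag_def by auto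

lemma zigzag_last: "odd p \<Longrightarrow> 2 * zigzag (p - 1) = 1 - int p"
  unfolding zigzag_def by (auto elim!: oddE)

lemma zigzag_bound: "2 * \<bar>zigzag k\<bar> \<le> int k + 1"
  unfolding zigzag_def by (auto elim!: evenE oddE)

lemma zigzag_inj: "zigzag k = zigzag l \<Longrightarrow> k = l"
  unfolding zigzag_def by (auto split: if_splits elim!: evenE oddE)

lemma int_dvd_less_imp_zero:
  fixes x d :: int
  assumes "d dvd x" "\<bar>x\<bar> < d"
  shows "x = 0"
  using assms dvd_imp_le_int[of x d] by fastforce

lemma zigzag_inj_mod:
  assumes "k < p" "l < p" "k \<noteq> l" "odd p"
  shows "\<not> int p dvd zigzag k - zigzag l"
proof
  assume dvd: "int p dvd zigzag k - zigzag l"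
  have "2 * \<bar>zigzag k\<bar> \<le> int p" "2 * \<bar>zigzag l\<bar> \<le> int p"
    using zigzag_bound[of k] zigzag_bound[of l] assms(1,2) by linarith+
  moreover have "2 * \<bar>zigzag k\<bar> \<noteq> int p" using assms(4) by presburger
  ultimately have "\<bar>zigzag k - zigzag l\<bar> < int p" by linarith
  then show False using int_dvd_less_imp_zero[OF dvd] zigzag_inj assms(3) by auto
qed

lemma int_prime_dvd_mult_cancel:
  assumes "prime (p::nat)" "int p dvd d * x" "d \<noteq> 0" "\<bar>d\<bar> < int p"
  shows "int p dvd x"
proof -
  have "\<not> int p dvd d" using int_dvd_less_imp_zero assms(3,4) by blast
  then show ?thesis using assms(1,2) by (simp add: prime_dvd_mult_iff)
qed

lemma odd_prime_ge_3: "prime (p::nat) \<Longrightarrow> odd p \<Longrightarrow> p \<ge> 3"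
  using prime_ge_2_nat[of p] by (cases "p = 2") auto

section \<open>The complete graph on p + 1 vertices\<close>

text \<open>For colours \<open>i\<close> and \<open>j\<close>, start at the half \<open>s\<close> of \<open>i\<close>
  and take the zigzag with \<open>d = j - i\<close>. It ends at the half of \<open>j\<close>, so both ends
  can be joined to infinity with the colours \<open>i\<close> and \<open>j\<close>.\<close>

lemma max_good_hamiltonian_prime_plus_1:
  assumes p: "prime p" "odd p"
  shows "max_good hamiltonian_graphs (p + 1) = 2 ^ (p + 1 - 2)"
proof -
  have p3: "p \<ge> 3" using odd_prime_ge_3 p .
  define col :: "nat \<Rightarrow> nat \<Rightarrow> int" where
    "col a b = (if a = p + 1 then 2 * int b else if b = p + 1 then 2 * int a else int a + int b)
       mod int p" for a b
  show ?thesis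
  proof (rule max_good_hamiltonian_of_colouring[where col = col and C = "{0..<int p}"])
    show "col a b = col b a" for a b by (simp add: col_def add.commute)
  next
    fix i j assume ij: "i \<in> {0..<int p}" "j \<in> {0..<int p}" "i \<noteq> j"
    \<comment> \<open>\<open>(p + 1) / 2\<close> is the inverse of \<open>2\<close> modulo \<open>p\<close>; vertex \<open>p + 1\<close> is infinity.\<close>
    define s where "s = i * ((int p + 1) div 2)"
    define y where "y k = s + (j - i) * zigzag k" for k
    define x where "x k = (if k < p then residue_vertex p (y k) else p + 1)" for k
    have s: "2 * s = i + i * int p"
      using p(2) unfolding s_def by (auto elim!: oddE simp: algebra_simps)
    have rng: "residue_vertex p z \<in> {1..p}" for z using p3 by (intro residue_vertex_range) simp
    have cong: "int p dvd int (residue_vertex p z) - z" for z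
      using p3 by (intro residue_vertex_cong) simp
    have col_sum: "col (x k) (x l) = c"
      if "k < p" "l < p" "int p dvd y k + y l - c" "c \<in> {0..<int p}" for k l c
    proof -
      have "col (x k) (x l) = (int (x k) + int (x l)) mod int p"
        using rng[of "y k"] rng[of "y l"] that(1,2) by (auto simp: col_def x_def)
      moreover have "int p dvd (int (x k) - y k) + (int (x l) - y l) + (y k + y l - c)"
        using that(1,2,3) cong[of "y k"] cong[of "y l"] by (intro dvd_add) (auto simp: x_def)
      then have "int p dvd int (x k) + int (x l) - c" by (simp add: algebra_simps)
      ultimately show ?thesis using that(4) by (auto intro: mod_eqI)
    qed
    have col_inf: "col (x k) (x p) = c" "col (x p) (x k) = c"
      if "k < p" "int p dvd 2 * y k - c" "c \<in> {0..<int p}" for k c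
    proof -
      have "int p dvd 2 * (int (x k) - y k) + (2 * y k - c)"
        using that(1,2) cong[of "y k"] by (intro dvd_add dvd_mult) (auto simp: x_def)
      then have "int p dvd 2 * int (x k) - c" by (simp add: algebra_simps)
      then have "2 * int (x k) mod int p = c" using that(3) by (auto intro: mod_eqI)
      then show "col (x k) (x p) = c" "col (x p) (x k) = c"
        using rng[of "y k"] that(1) by (auto simp: col_def x_def)
    qed
    show "\<exists>x. inj_on x {..<p + 1} \<and> x ` {..<p + 1} \<subseteq> {1..p + 1} \<and>
        (\<forall>k<p + 1. col (x k) (x (Suc k mod (p + 1))) \<in> {i, j})"
    proof (intro exI[of _ x] conjI allI impI)
      show "inj_on x {..<p + 1}"
      proof (rule inj_onI)
        fix k l assume kl: "k \<in> {..<p + 1}" "l \<in> {..<p + 1}" "x k = x l"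
        show "k = l"
        proof (cases "k < p \<and> l < p")
          case True
          then have "int p dvd y k - y l"
            using kl(3) p3 by (intro residue_vertex_eqD) (auto simp: x_def)
          then have "int p dvd (j - i) * (zigzag k - zigzag l)"
            by (simp add: y_def algebra_simps)
          then have "int p dvd zigzag k - zigzag l"
            by (rule int_prime_dvd_mult_cancel[OF p(1)]) (use ij in auto)
          then show ?thesis using zigzag_inj_mod p(2) True by blast
        next
          case False
          then show ?thesis using kl rng[of "y k"] rng[of "y l"]
            by (auto simp: x_def split: if_splits)
        qed
      qed
      show "x ` {..<p + 1} \<subseteq> {1..p + 1}"
        using rng by (fastforce simp: x_def)
    next
      fix k assume "k < p + 1"
      then consider "k = p" | "k = p - 1" | "Suc k < p" by linarith
      then show "col (x k) (x (Suc k mod (p + 1))) \<in> {i, j}"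
      proof cases
        case 1
        have "col (x p) (x 0) = i"
          using p3 s ij by (intro col_inf) (auto simp: y_def zigzag_0)
        then show ?thesis using 1 by simp
      next
        case 2
        have "2 * y (p - 1) = 2 * s + (j - i) * (2 * zigzag (p - 1))"
          by (simp add: y_def algebra_simps)
        also have "\<dots> - j = int p * (2 * i - j)"
          unfolding zigzag_last[OF p(2)] s by (simp add: algebra_simps)
        finally have "col (x (p - 1)) (x p) = j"
          using p3 ij by (intro col_inf) auto
        then show ?thesis using 2 p3 by simp
      next
        case 3
        define c where "c = (if even k then j else i)"
        have "y k + y (Suc k) = 2 * s + (j - i) * (zigzag k + zigzag (Suc k))"
          by (simp add: y_def algebra_simps)
        also have "\<dots> - c = int p * i"
          unfolding zigzag_step s c_def by (simp add: algebra_simps)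
        finally have "col (x k) (x (Suc k)) = c"
          using 3 ij by (intro col_sum) (auto simp: c_def)
        then show ?thesis using 3 by (simp add: c_def)
      qed
    qed
  qed (use p3 in auto)
qed

section \<open>The complete graph on 2p vertices\<close>

text \<open>This is the colouring behind the classical factorization of the complete graph on
  \<open>2p\<close> vertices. Edges \<open>{a, a + p}\<close> fill the two places that the equation
  \<open>2a = i\<close> leaves uncovered in the class of an even sum \<open>i\<close>; accordingly the odd
  difference \<open>p\<close> is not a colour.\<close>

definition sum_difference_colour :: "nat \<Rightarrow> int \<Rightarrow> int \<Rightarrow> int" where
  "sum_difference_colour p a b =
    (if even (a + b) then (a + b) mod (2 * int p)
     else if 2 * int p dvd a - b - int p then 2 * a mod (2 * int p)
     else if odd a then (b - a) mod (2 * int p) else (a - b) mod (2 * int p))"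

lemma sum_difference_colour_commute:
  "sum_difference_colour p a b = sum_difference_colour p b a"
proof -
  have swap: "2 * int p dvd v - u - int p" if "2 * int p dvd u - v - int p" for u v :: int
  proof -
    have "2 * int p dvd - (u - v - int p) - 2 * int p"
      using that by (intro dvd_diff dvd_refl) (simp only: dvd_minus_iff)
    then show ?thesis by (simp add: algebra_simps)
  qed
  have sym: "2 * int p dvd b - a - int p \<longleftrightarrow> 2 * int p dvd a - b - int p"
    using swap by blast
  have "2 * a mod (2 * int p) = 2 * b mod (2 * int p)" if "2 * int p dvd a - b - int p"
  proof -
    have "2 * int p dvd 2 * (a - b - int p) + 2 * int p" 
      by (rule dvd_add[OF dvd_mult[OF that] dvd_refl])
    moreover have "2 * (a - b - int p) + 2 * int p = 2 * a - 2 * b" by simp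
    ultimately show ?thesis by (simp only: mod_eq_dvd_iff)
  qed
  then show ?thesis
    using sym unfolding sum_difference_colour_def by (auto simp: add.commute)
qed

lemma sum_difference_colour_cong_left:
  assumes "2 * int p dvd a - a'"
  shows "sum_difference_colour p a b = sum_difference_colour p a' b"
proof -
  obtain t where "a - a' = 2 * int p * t" using assms by (elim dvdE)
  then have a: "a = a' + 2 * int p * t" by simp
  have "2 * int p dvd a - b - int p \<longleftrightarrow> 2 * int p dvd a' - b - int p"
  proof -
    have "a - b - int p = 2 * int p * t + (a' - b - int p)" using a by simp
    then show ?thesis by (metis dvd_add_right_iff dvd_triv_left)
  qed
  moreover have "(a + b) mod (2 * int p) = (a' + b) mod (2 * int p)"
    "2 * a mod (2 * int p) = 2 * a' mod (2 * int p)"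
    "(b - a) mod (2 * int p) = (b - a') mod (2 * int p)"
    "(a - b) mod (2 * int p) = (a' - b) mod (2 * int p)"
    unfolding mod_eq_dvd_iff a by (simp_all add: algebra_simps)
  moreover have "even a = even a'" using a by simp
  ultimately show ?thesis unfolding sum_difference_colour_def by simp
qed

text \<open>The colour depends only on residues, so walks can be described with plain integers.\<close>

lemma sum_difference_colour_cong:
  assumes "2 * int p dvd a - a'" "2 * int p dvd b - b'"
  shows "sum_difference_colour p a b = sum_difference_colour p a' b'"
  using sum_difference_colour_cong_left[OF assms(1), of b]
    sum_difference_colour_cong_left[OF assms(2), of a']
    sum_difference_colour_commute[of p a' b] sum_difference_colour_commute[of p a' b']
  by simp

lemma sum_difference_colour_sum:
  assumes "even (a + b)" "2 * int p dvd a + b - i" "i \<in> {0..<2 * int p}"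
  shows "sum_difference_colour p a b = i"
  using assms unfolding sum_difference_colour_def by (auto intro: mod_eqI)

lemma sum_difference_colour_antipodal:
  assumes "odd p" "2 * int p dvd a - b - int p" "2 * int p dvd 2 * a - i" "i \<in> {0..<2 * int p}"
  shows "sum_difference_colour p a b = i"
proof -
  have "even (a - b - int p)" using assms(2) by (rule dvd_mult_left)
  then have "odd (a + b)" using assms(1) by simp
  moreover have "2 * a mod (2 * int p) = i" by (rule mod_eqI) (use assms(3,4) in auto)
  ultimately show ?thesis
    using assms(2) unfolding sum_difference_colour_def by simp
qed

lemma sum_difference_colour_difference:
  assumes "odd a" "2 * int p dvd b - a - i" "odd i" "i \<noteq> int p" "i \<in> {0..<2 * int p}"
  shows "sum_difference_colour p a b = i"
proof -
  have "even (b - a - i)" using assms(2) by (rule dvd_mult_left)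
  then have "odd (a + b)" using assms(3) by auto
  moreover have "\<not> 2 * int p dvd a - b - int p"
  proof
    assume "2 * int p dvd a - b - int p"
    then have "2 * int p dvd (a - b - int p) + (b - a - i) + 2 * int p"
      using assms(2) by (intro dvd_add) auto
    then have "2 * int p dvd int p - i" by (simp add: algebra_simps)
    then have "int p - i = 0" by (rule int_dvd_less_imp_zero) (use assms(5) in auto)
    then show False using assms(4) by simp
  qed
  ultimately show ?thesis
    using assms unfolding sum_difference_colour_def by (auto intro: mod_eqI)
qed

text \<open>A cyclic walk through \<open>2p\<close> distinct residues modulo \<open>2p\<close>, given by
  integer representatives, with all edges of colour \<open>i\<close> or \<open>j\<close>.\<close>

definition two_coloured_cycle :: "nat \<Rightarrow> int \<Rightarrow> int \<Rightarrow> bool" where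
  "two_coloured_cycle p i j \<longleftrightarrow>
    (\<exists>y. (\<forall>k<2 * p. \<forall>l<2 * p. 2 * int p dvd y k - y l \<longrightarrow> k = l) \<and>
         (\<forall>k<2 * p. sum_difference_colour p (y k) (y (Suc k mod (2 * p))) \<in> {i, j}))"

lemma two_coloured_cycle_commute: "two_coloured_cycle p i j = two_coloured_cycle p j i"
  unfolding two_coloured_cycle_def by (simp add: insert_commute)

text \<open>Edges with even sum stay inside a parity class. A zigzag through the class of
  \<open>s = i / 2\<close> ends at a solution of \<open>2x = j\<close>. There the edge \<open>{x, x + p}\<close>
  of colour \<open>j\<close> leads to the other class, which is traversed by the same zigzag, shifted
  by \<open>p\<close> and reversed; the edge \<open>{s + p, s}\<close> of colour \<open>i\<close> closes the
  cycle.\<close>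

lemma two_coloured_cycle_even_even:
  assumes p: "prime p" "odd p"
    and i: "i \<in> {0..<2 * int p}" "even i" and j: "j \<in> {0..<2 * int p}" "even j"
    and "i \<noteq> j"
  shows "two_coloured_cycle p i j"
proof -
  have p3: "p \<ge> 3" using odd_prime_ge_3 p .
  define s where "s = i div 2"
  define e where "e = j div 2 - i div 2"
  define u where "u k = s + 2 * e * zigzag k" for k
  define y where "y k = (if k < p then u k else u (2 * p - 1 - k) + int p)" for k
  have s: "2 * s = i" and e: "2 * e = j - i" using i(2) j(2) by (auto simp: s_def e_def)
  have e_small: "e \<noteq> 0" "\<bar>e\<bar> < int p" using e i(1) j(1) \<open>i \<noteq> j\<close> by auto
  have u_sum: "u k + u (Suc k) = (if even k then j else i)" for k
  proof -
    have "u k + u (Suc k) = 2 * s + 2 * e * (zigzag k + zigzag (Suc k))"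
      by (simp add: u_def algebra_simps)
    then show ?thesis unfolding zigzag_step s e by simp
  qed
  have parity: "even (u k) = even s" for k by (simp add: u_def)
  have u_inj: "k = l" if "k < p" "l < p" "2 * int p dvd u k - u l" for k l
  proof -
    have "u k - u l = 2 * (e * (zigzag k - zigzag l))" by (simp add: u_def algebra_simps)
    then have "int p dvd e * (zigzag k - zigzag l)" using that(3) by simp
    then have "int p dvd zigzag k - zigzag l"
      by (rule int_prime_dvd_mult_cancel[OF p(1)]) (use e_small in auto)
    then show ?thesis using zigzag_inj_mod that(1,2) p(2) by blast
  qed
  have u_mixed: "\<not> 2 * int p dvd u k - (u l + int p)" "\<not> 2 * int p dvd (u k + int p) - u l" for k l
  proof -
    have "odd (u k - (u l + int p))" "odd ((u k + int p) - u l)"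
      using parity[of k] parity[of l] p(2) by auto
    then show "\<not> 2 * int p dvd u k - (u l + int p)" "\<not> 2 * int p dvd (u k + int p) - u l"
      by (meson dvd_mult_left)+
  qed
  show ?thesis
    unfolding two_coloured_cycle_def
  proof (intro exI[of _ y] conjI allI impI)
    fix k l assume kl: "k < 2 * p" "l < 2 * p" "2 * int p dvd y k - y l"
    consider "k < p" "l < p" | "k < p" "\<not> l < p" | "\<not> k < p" "l < p" | "\<not> k < p" "\<not> l < p"
      by blast
    then show "k = l"
    proof cases
      case 1
      then show ?thesis using u_inj kl(3) by (simp add: y_def)
    next
      case 2
      then show ?thesis using u_mixed(1) kl(3) by (simp add: y_def)
    next
      case 3
      then show ?thesis using u_mixed(2) kl(3) by (simp add: y_def)
    next
      case 4
      then have "2 * p - 1 - k = 2 * p - 1 - l" using u_inj kl by (simp add: y_def)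
      then show ?thesis using kl(1,2) by linarith
    qed
  next
    fix k assume "k < 2 * p"
    then consider "Suc k < p" | "k = p - 1" | "p \<le> k" "Suc k < 2 * p" | "k = 2 * p - 1"
      by linarith
    then show "sum_difference_colour p (y k) (y (Suc k mod (2 * p))) \<in> {i, j}"
    proof cases
      case 1
      have "sum_difference_colour p (u k) (u (Suc k)) = (if even k then j else i)"
        unfolding u_sum[symmetric]
        by (rule sum_difference_colour_sum) (use u_sum[of k] i j in auto)
      then show ?thesis using 1 by (simp add: y_def)
    next
      case 2
      have "2 * u (p - 1) - j = 2 * s + 2 * e * (2 * zigzag (p - 1)) - j"
        by (simp add: u_def)
      also have "\<dots> = (2 * int p) * (- e)"
        unfolding zigzag_last[OF p(2)] s using e by (simp add: algebra_simps)
      finally have "2 * int p dvd 2 * (u (p - 1) + int p) - j"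
        by (metis add.commute add_diff_eq distrib_left dvd_add dvd_refl dvd_triv_left)
      then have "sum_difference_colour p (u (p - 1) + int p) (u (p - 1)) = j"
        by (intro sum_difference_colour_antipodal) (use p j in auto)
      moreover have "y k = u (p - 1)" "y (Suc k mod (2 * p)) = u (p - 1) + int p"
        using 2 p3 by (auto simp: y_def)
      ultimately show ?thesis by (simp add: sum_difference_colour_commute)
    next
      case 3
      define l where "l = 2 * p - 1 - Suc k"
      have l: "2 * p - 1 - k = Suc l" using 3 by (simp add: l_def)
      have "sum_difference_colour p (u (Suc l) + int p) (u l + int p) = (if even l then j else i)"
        by (rule sum_difference_colour_sum) (use u_sum[of l] i j in \<open>auto simp: algebra_simps\<close>)
      moreover have "y k = u (Suc l) + int p" "y (Suc k mod (2 * p)) = u l + int p"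
        using 3 l by (auto simp: y_def l_def)
      ultimately show ?thesis by simp
    next
      case 4
      have "sum_difference_colour p (s + int p) s = i"
        by (rule sum_difference_colour_antipodal) (use p s i in \<open>auto simp: algebra_simps\<close>)
      moreover have "y k = s + int p" "y (Suc k mod (2 * p)) = s"
        using 4 p3 by (auto simp: y_def u_def zigzag_0)
      ultimately show ?thesis by simp
    qed
  qed
qed

text \<open>From an odd residue go up by \<open>i\<close>, then down by \<open>j\<close>. Every second step
  advances by \<open>i - j\<close>, an even number that \<open>p\<close> does not divide, so the walk runs
  through all odd residues before it returns, and through all even ones in between.\<close>

lemma two_coloured_cycle_odd_odd:
  assumes p: "prime p" "odd p"
    and i: "i \<in> {0..<2 * int p} - {int p}" "odd i" and j: "j \<in> {0..<2 * int p} - {int p}" "odd j"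
    and "i \<noteq> j"
  shows "two_coloured_cycle p i j"
proof -
  have p3: "p \<ge> 3" using odd_prime_ge_3 p .
  define y where "y k = 1 + int (k div 2) * (i - j) + (if even k then 0 else i)" for k
  have parity: "odd (y k) \<longleftrightarrow> even k" for k using i(2) j(2) by (simp add: y_def)
  define e where "e = (i - j) div 2"
  have e: "2 * e = i - j" using i(2) j(2) by (simp add: e_def)
  have e_small: "e \<noteq> 0" "\<bar>e\<bar> < int p" using e i(1) j(1) \<open>i \<noteq> j\<close> by auto
  show ?thesis
    unfolding two_coloured_cycle_def
  proof (intro exI[of _ y] conjI allI impI)
    fix k l assume kl: "k < 2 * p" "l < 2 * p" "2 * int p dvd y k - y l"
    have "even (y k - y l)" using kl(3) by (rule dvd_mult_left)
    then have same: "even k \<longleftrightarrow> even l" using parity[of k] parity[of l] by auto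
    then have "y k - y l = (int (k div 2) - int (l div 2)) * (2 * e)"
      unfolding e by (simp add: y_def algebra_simps)
    then have "2 * int p dvd 2 * (e * (int (k div 2) - int (l div 2)))"
      using kl(3) by (simp add: mult_ac)
    then have "int p dvd e * (int (k div 2) - int (l div 2))" by simp
    then have "int p dvd int (k div 2) - int (l div 2)"
      by (rule int_prime_dvd_mult_cancel[OF p(1)]) (use e_small in auto)
    then have "int (k div 2) - int (l div 2) = 0"
      by (rule int_dvd_less_imp_zero) (use kl(1,2) in linarith)
    then have "k div 2 = l div 2" by simp
    then show "k = l" using same by (metis even_two_times_div_two odd_two_times_div_two_succ)
  next
    fix k assume "k < 2 * p"
    then consider "even k" "Suc k < 2 * p" | "odd k" "Suc k < 2 * p" | "k = 2 * p - 1"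
      using p3 by linarith
    then show "sum_difference_colour p (y k) (y (Suc k mod (2 * p))) \<in> {i, j}"
    proof cases
      case 1
      have "y (Suc k) - y k = i" using 1 by (simp add: y_def)
      moreover have "odd (y k)" using 1 parity by simp
      ultimately have "sum_difference_colour p (y k) (y (Suc k)) = i"
        by (intro sum_difference_colour_difference) (use i in auto)
      then show ?thesis using 1 by simp
    next
      case 2
      have "y k - y (Suc k) = j"
        using 2 by (simp add: y_def algebra_simps)
      moreover have "odd (y (Suc k))" using 2 parity by simp
      ultimately have "sum_difference_colour p (y (Suc k)) (y k) = j"
        by (intro sum_difference_colour_difference) (use j in auto)
      then show ?thesis using 2 by (simp add: sum_difference_colour_commute)
    next
      case 3
      have "odd k" "k div 2 = p - 1" using 3 p3 by auto
      then have "y k - y 0 - j = int p * (i - j)"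
        using p3 by (simp add: y_def algebra_simps of_nat_diff)
      also have "\<dots> = (2 * int p) * e" using e by simp
      finally have "2 * int p dvd y k - y 0 - j" by simp
      moreover have "odd (y 0)" using parity by simp
      ultimately have "sum_difference_colour p (y 0) (y k) = j"
        by (intro sum_difference_colour_difference) (use j in auto)
      then show ?thesis using 3 p3 by (simp add: sum_difference_colour_commute)
    qed
  qed
qed

text \<open>The sequence 0, 1, -1, -2, 2, 3, -3, -4, 4, ...: a step of \<open>\<plusminus>1\<close> away from
  zero alternates with a change of sign. Its first \<open>2p\<close> values, for odd \<open>p\<close>, run
  from \<open>0\<close> to \<open>p\<close> through all integers \<open>t\<close> with
  \<open>-p < t \<le> p\<close>.\<close>

definition double_zigzag :: "nat \<Rightarrow> int" where
  "double_zigzag k = (if even (k div 2) then int (Suc k div 2) else - int (Suc k div 2))"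

lemma double_zigzag_inj:
  assumes "double_zigzag k = double_zigzag l"
  shows "k = l"
proof -
  have half: "Suc k div 2 = Suc l div 2"
    and sign: "Suc k div 2 = 0 \<or> even (k div 2) = even (l div 2)"
    using assms unfolding double_zigzag_def by (auto split: if_splits)
  have flip: "even (a div 2) \<noteq> even (Suc a div 2)" "Suc a div 2 \<noteq> 0"
    if "Suc a div 2 = Suc (Suc a) div 2" for a :: nat
    using that by (cases "even a"; auto elim!: evenE oddE)+
  consider "k = l" | "l = Suc k" | "k = Suc l" using half by linarith
  then show ?thesis
  proof cases
    case 2
    then show ?thesis using flip[of k] half sign by simp
  next
    case 3
    then show ?thesis using flip[of l] half[symmetric] sign by auto
  qed
qed

text \<open>Let \<open>s\<close> be the odd solution of \<open>2s = i\<close> and write residues as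
  \<open>s + t * j\<close>, which is possible since \<open>j\<close> is coprime to \<open>2p\<close>. Edges of
  sum \<open>i\<close> change \<open>t\<close> to \<open>-t\<close>; edges of difference \<open>j\<close>
  increase \<open>t\<close> at odd residues, that is at even \<open>t\<close>, and decrease it at odd
  \<open>t\<close>. This is the rule of the double zigzag from \<open>t = 0\<close> to \<open>t = p\<close>,
  whose ends are joined by the edge \<open>{s, s + p}\<close> of colour \<open>i\<close>.\<close>

lemma two_coloured_cycle_even_odd:
  assumes p: "prime p" "odd p"
    and i: "i \<in> {0..<2 * int p}" "even i" and j: "j \<in> {0..<2 * int p} - {int p}" "odd j"
  shows "two_coloured_cycle p i j"
proof -
  have p3: "p \<ge> 3" using odd_prime_ge_3 p .
  define s where "s = (if odd (i div 2) then i div 2 else i div 2 + int p)"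
  have s: "odd s" "2 * int p dvd 2 * s - i" using i p by (auto simp: s_def)
  define y where "y k = s + double_zigzag k * j" for k
  have parity: "odd (y k) \<longleftrightarrow> even (double_zigzag k)" for k using s(1) j(2) by (simp add: y_def)
  have cop: "coprime (2 * int p) j"
  proof -
    have "\<not> int p dvd j"
    proof
      assume "int p dvd j"
      have "j \<noteq> 0" using j(2) by auto
      have "int p dvd j - int p" using \<open>int p dvd j\<close> by simp
      then have "j - int p = 0" by (rule int_dvd_less_imp_zero) (use j \<open>j \<noteq> 0\<close> in auto)
      then show False using j by simp
    qed
    then have "coprime (int p) j" using p(1) by (intro prime_imp_coprime) auto
    then show ?thesis using j(2) by simp
  qed
  have bounds: "double_zigzag k \<le> int p" "- int p < double_zigzag k" if "k < 2 * p" for k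
  proof -
    have "Suc k div 2 \<le> p" using that by linarith
    moreover have "Suc k div 2 \<noteq> p" if "odd (k div 2)"
    proof
      assume "Suc k div 2 = p"
      then have "k = 2 * p - 1" using \<open>k < 2 * p\<close> by linarith
      then have "k div 2 = p - 1" using p3 by linarith
      then show False using that p(2) p3 by simp
    qed
    ultimately show "double_zigzag k \<le> int p" "- int p < double_zigzag k"
      using p3 by (auto simp: double_zigzag_def)
  qed
  show ?thesis
    unfolding two_coloured_cycle_def
  proof (intro exI[of _ y] conjI allI impI)
    fix k l assume kl: "k < 2 * p" "l < 2 * p" "2 * int p dvd y k - y l"
    have "y k - y l = (double_zigzag k - double_zigzag l) * j" by (simp add: y_def algebra_simps)
    then have "2 * int p dvd double_zigzag k - double_zigzag l"
      using kl(3) cop by (metis coprime_dvd_mult_left_iff)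
    then have "double_zigzag k - double_zigzag l = 0"
      by (rule int_dvd_less_imp_zero) (use bounds[OF kl(1)] bounds[OF kl(2)] in linarith)
    then show "k = l" using double_zigzag_inj by simp
  next
    fix k assume "k < 2 * p"
    then consider "even k" "even (k div 2)" "Suc k < 2 * p"
      | "even k" "odd (k div 2)" "Suc k < 2 * p" | "odd k" "Suc k < 2 * p" | "k = 2 * p - 1"
      using p3 by linarith
    then show "sum_difference_colour p (y k) (y (Suc k mod (2 * p))) \<in> {i, j}"
    proof cases
      case 1
      have step: "double_zigzag (Suc k) = double_zigzag k + 1" "even (double_zigzag k)"
        using 1 by (auto simp: double_zigzag_def)
      have "y (Suc k) - y k = j"
        unfolding y_def step(1) by (simp add: algebra_simps)
      moreover have "odd (y k)" using parity[of k] step(2) by simp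
      ultimately have "sum_difference_colour p (y k) (y (Suc k)) = j"
        by (intro sum_difference_colour_difference) (use j in auto)
      then show ?thesis using 1 by simp
    next
      case 2
      have step: "double_zigzag (Suc k) = double_zigzag k - 1" "odd (double_zigzag k)"
        using 2 by (auto simp: double_zigzag_def)
      have "y k - y (Suc k) = j"
        unfolding y_def step(1) by (simp add: algebra_simps)
      moreover have "odd (y (Suc k))" using parity[of "Suc k"] step by simp
      ultimately have "sum_difference_colour p (y (Suc k)) (y k) = j"
        by (intro sum_difference_colour_difference) (use j in auto)
      then show ?thesis using 2 by (simp add: sum_difference_colour_commute)
    next
      case 3
      have "double_zigzag (Suc k) = - double_zigzag k"
        using 3 by (auto simp: double_zigzag_def elim!: oddE)
      then have "y k + y (Suc k) = 2 * s" by (simp add: y_def)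
      then have "sum_difference_colour p (y k) (y (Suc k)) = i"
        by (intro sum_difference_colour_sum) (use i s in auto)
      then show ?thesis using 3 by simp
    next
      case 4
      have "double_zigzag k = int p" "double_zigzag 0 = 0"
        using 4 p(2) p3 by (auto simp: double_zigzag_def elim!: oddE)
      then have yk: "y k = s + int p * j" "y 0 = s" by (simp_all add: y_def)
      have "y k - y 0 - int p = int p * (j - 1)" unfolding yk by (simp add: algebra_simps)
      moreover have "2 * int p dvd int p * (j - 1)"
        using j(2) by (simp add: mult.commute mult_dvd_mono)
      ultimately have "2 * int p dvd y k - y 0 - int p" by simp
      moreover have "2 * int p dvd (2 * s - i) + 2 * int p * j"
        using s(2) by (intro dvd_add) simp_all
      then have "2 * int p dvd 2 * y k - i" unfolding yk by (simp add: algebra_simps)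
      ultimately have "sum_difference_colour p (y k) (y 0) = i"
        by (intro sum_difference_colour_antipodal) (use p i in auto)
      then show ?thesis using 4 p3 by simp
    qed
  qed
qed

lemma max_good_hamiltonian_double_prime:
  assumes p: "prime p" "odd p"
  shows "max_good hamiltonian_graphs (2 * p) = 2 ^ (2 * p - 2)"
proof -
  have p3: "p \<ge> 3" using odd_prime_ge_3 p .
  let ?C = "{0..<2 * int p} - {int p}"
  let ?col = "\<lambda>a b. sum_difference_colour p (int a) (int b)"
  show ?thesis
  proof (rule max_good_hamiltonian_of_colouring[where col = ?col and C = ?C])
    show "?col a b = ?col b a" for a b by (rule sum_difference_colour_commute)
    show "card ?C = 2 * p - 1" using p3 by (subst card_Diff_singleton) auto
  next
    fix i j assume ij: "i \<in> ?C" "j \<in> ?C" "i \<noteq> j"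
    have "two_coloured_cycle p i j"
    proof (cases "even i"; cases "even j")
      assume "even i" "even j"
      then show ?thesis using two_coloured_cycle_even_even[OF p] ij by blast
    next
      assume "even i" "odd j"
      then show ?thesis using two_coloured_cycle_even_odd[OF p] ij by blast
    next
      assume "odd i" "even j"
      then show ?thesis
        using two_coloured_cycle_even_odd[OF p] two_coloured_cycle_commute ij by blast
    next
      assume "odd i" "odd j"
      then show ?thesis using two_coloured_cycle_odd_odd[OF p] ij by blast
    qed
    then obtain y where
      inj: "\<And>k l. k < 2 * p \<Longrightarrow> l < 2 * p \<Longrightarrow> 2 * int p dvd y k - y l \<Longrightarrow> k = l" and
      col: "\<And>k. k < 2 * p \<Longrightarrow> sum_difference_colour p (y k) (y (Suc k mod (2 * p))) \<in> {i, j}"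
      unfolding two_coloured_cycle_def by blast
    define x where "x k = residue_vertex (2 * p) (y k)" for k
    have cong: "2 * int p dvd int (x k) - y k" for k
      using residue_vertex_cong[of "2 * p" "y k"] p3 by (simp add: x_def)
    show "\<exists>x. inj_on x {..<2 * p} \<and> x ` {..<2 * p} \<subseteq> {1..2 * p} \<and>
        (\<forall>k<2 * p. ?col (x k) (x (Suc k mod (2 * p))) \<in> {i, j})"
    proof (intro exI[of _ x] conjI allI impI)
      show "inj_on x {..<2 * p}"
      proof (rule inj_onI)
        fix k l assume kl: "k \<in> {..<2 * p}" "l \<in> {..<2 * p}" "x k = x l"
        then have "int (2 * p) dvd y k - y l"
          using p3 by (intro residue_vertex_eqD) (auto simp: x_def)
        then show "k = l" using inj kl(1,2) by simp
      qed
      show "x ` {..<2 * p} \<subseteq> {1..2 * p}"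
        using p3 unfolding x_def by (intro image_subsetI residue_vertex_range) simp
      show "?col (x k) (x (Suc k mod (2 * p))) \<in> {i, j}" if "k < 2 * p" for k
        using col[OF that] sum_difference_colour_cong[OF cong cong] by simp
    qed
  qed (use p3 in auto)
qed

theorem theorem6:
  shows "(\<forall>n::nat. even n \<and> n > 2 \<and> (\<exists>P. perfect_1_factorization (complete_graph n) P) \<longrightarrow>
            max_good hamiltonian_graphs n = 2 ^ (n - 2)) \<and>
         (\<forall>p n :: nat. prime p \<and> odd p \<and> (n = p + 1 \<or> n = 2 * p) \<longrightarrow>
            max_good hamiltonian_graphs n = 2 ^ (n - 2))"
proof (intro conjI allI impI)
  fix n :: nat
  assume "even n \<and> n > 2 \<and> (\<exists>P. perfect_1_factorization (complete_graph n) P)"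
  then obtain P where "perfect_1_factorization (complete_graph n) P" "n \<ge> 3" by auto
  then show "max_good hamiltonian_graphs n = 2 ^ (n - 2)"
    by (rule max_good_hamiltonian_of_factorization)
next
  fix p n :: nat
  assume "prime p \<and> odd p \<and> (n = p + 1 \<or> n = 2 * p)"
  then have p: "prime p" "odd p" and n: "n = p + 1 \<or> n = 2 * p" by auto
  show "max_good hamiltonian_graphs n = 2 ^ (n - 2)"
    using n max_good_hamiltonian_prime_plus_1[OF p] max_good_hamiltonian_double_prime[OF p] by metis
qed

end
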